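(* Let $q\ge2$, $\sigma>0$, and let $\mathbf{Z}_1,\dots,\mathbf{Z}_n$ be independent real-valued random variables with $\mathbb{E}[\mathbf{Z}_i]=0$, $\mathbb{E}[\mathbf{Z}_i^2]=1$ and $\mathbb{E}[|\mathbf{Z}_i|^q]\le\sigma^{2-q}$. Let $f=\sum_{S\subseteq[n]}a_S\prod_{i\in S}\mathbf{Z}_i$ with real coefficients $a_S$, and let $0<\rho<\frac{1}{2q^{1.5}}$. Then \[\|\mathrm{T}_\rho f\|_q^q\le\sum_{S\subseteq[n]}\sigma^{(2-q)|S|}\|\mathrm{D}_S(f)\|_2^q.\]
   Context: For $f=\sum_S a_S\prod_{i\in S}\mathbf{Z}_i$: $\mathrm{T}_\rho f=\sum_S\rho^{|S|}a_S\prod_{i\in S}\mathbf{Z}_i$ and $\mathrm{D}_T(f)=\sum_{S\supseteq T}a_S\prod_{i\in S\setminus T}\mathbf{Z}_i$. Norms are $L^r$ norms of these random variables. *)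

theory Defs
  imports "HOL-Probability.Probability"
begin

text \<open>Only meaningful when \<open>\<bar>X\<bar> powr r\<close> is integrable: otherwise the Bochner integral is 0.\<close>

definition Lr_norm :: "'w measure \<Rightarrow> real \<Rightarrow> ('w \<Rightarrow> real) \<Rightarrow> real" where
  "Lr_norm M r X = (\<integral>\<omega>. \<bar>X \<omega>\<bar> powr r \<partial>M) powr (1 / r)"

text \<open>
  The function \<open>f = (\<Sum>S\<subseteq>[n]. a S * (\<Prod>i\<in>S. Z i))\<close> is given by its family of
  coefficients \<open>a\<close>, indexed by the subsets of \<open>[n] = {1..n}\<close>. The operators are defined on the
  coefficients and return the resulting random variable; \<open>f\<close> itself is
  \<open>noise_op n Z 1 a = deriv_op n Z {} a\<close>.
\<close>

definition noise_op ::
    "nat \<Rightarrow> (nat \<Rightarrow> 'w \<Rightarrow> real) \<Rightarrow> real \<Rightarrow> (nat set \<Rightarrow> real) \<Rightarrow> 'w \<Rightarrow> real" where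
  "noise_op n Z \<rho> a \<omega> = (\<Sum>S\<in>Pow {1..n}. \<rho> ^ card S * a S * (\<Prod>i\<in>S. Z i \<omega>))"

definition deriv_op ::
    "nat \<Rightarrow> (nat \<Rightarrow> 'w \<Rightarrow> real) \<Rightarrow> nat set \<Rightarrow> (nat set \<Rightarrow> real) \<Rightarrow> 'w \<Rightarrow> real" where
  "deriv_op n Z T a \<omega> = (\<Sum>S\<in>{S. T \<subseteq> S \<and> S \<subseteq> {1..n}}. a S * (\<Prod>i\<in>S - T. Z i \<omega>))"

end

theory Submission
  imports Defs
begin

text \<open>
  Induct on the number of variables. Split off one variable, \<open>T f = G + \<rho> Z H\<close> with \<open>G\<close>, \<open>H\<close>
  independent of \<open>Z\<close>, and expand \<open>\<bar>G + \<rho> Z H\<bar>\<^sup>q\<close> to second order with a remainder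
  \<open>((q + 1) \<rho> \<bar>Z H\<bar>)\<^sup>q\<close>. The linear term has mean zero, and the remainder is controlled by the
  \<open>q\<close>-th moment of \<open>Z\<close> and the induction hypothesis for \<open>H\<close>. The remaining
  \<open>E[\<bar>G\<bar>\<^sup>q + (q/2) c\<^sup>2 \<bar>G\<bar>\<^sup>q\<^sup>-\<^sup>2 H\<^sup>2]\<close> with \<open>c = 1 / (\<surd>2 q)\<close> is at most the mean of
  \<open>E\<bar>G + c H\<bar>\<^sup>q\<close> and \<open>E\<bar>G - c H\<bar>\<^sup>q\<close>; apply the induction hypothesis to both and recombine
  the resulting \<open>L\<^sup>2\<close> norms by a two-point hypercontractive inequality.
\<close>

subsection \<open>Inequalities for real powers\<close>

text \<open>For negative x put \<open>y = - x\<close>: then \<open>exp x \<le> 1 / (1 + y)\<close>,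
  and \<open>(1 + y) * (1 - y + y\<^sup>2) = 1 + y ^ 3\<close> exceeds 1.\<close>

lemma exp_le_quadratic:
  fixes x :: real
  assumes "\<bar>x\<bar> \<le> 1"
  shows "exp x \<le> 1 + x + x\<^sup>2"
proof (cases "0 \<le> x")
  case True
  then show ?thesis using exp_bound assms by simp
next
  case False
  define y where "y = - x"
  have y: "y > 0" using False by (simp add: y_def)
  have "1 \<le> (1 + y) * (1 - y + y\<^sup>2)"
    using y by (simp add: algebra_simps power2_eq_square)
  then have "inverse (1 + y) \<le> 1 - y + y\<^sup>2"
    using y by (simp add: field_simps)
  moreover have "exp x \<le> inverse (1 + y)"
    using y exp_ge_add_one_self[of y] by (simp add: y_def exp_minus field_simps)
  ultimately show ?thesis by (simp add: y_def)
qed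

text \<open>If q|t| \<le> 1, then 1 + t \<le> exp t and the quadratic bound on exp at q t suffice.
  Otherwise |1 + t| \<le> (q + 1)|t|, so the last term alone dominates, and the quadratic polynomial
  is nonnegative.\<close>

lemma powr_one_plus_upper:
  fixes q t :: real
  assumes "q \<ge> 2"
  shows "\<bar>1 + t\<bar> powr q \<le> 1 + q * t + q\<^sup>2 * t\<^sup>2 + ((q + 1) * \<bar>t\<bar>) powr q"
proof (cases "q * \<bar>t\<bar> \<le> 1")
  case True
  have "2 * \<bar>t\<bar> \<le> q * \<bar>t\<bar>" using assms by (intro mult_right_mono) auto
  then have t: "1 + t > 0" using True by linarith
  have "(1 + t) powr q \<le> exp t powr q"
    using t assms exp_ge_add_one_self[of t] by (intro powr_mono2) auto
  also have "\<dots> = exp (q * t)" by (simp add: powr_def)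
  also have "\<dots> \<le> 1 + q * t + (q * t)\<^sup>2"
    using True assms by (intro exp_le_quadratic) (simp add: abs_mult)
  finally show ?thesis using t
    by (smt (verit) power_mult_distrib powr_ge_zero)
next
  case False
  have "\<bar>1 + t\<bar> \<le> (q + 1) * \<bar>t\<bar>" using False by (simp add: algebra_simps)
  then have "\<bar>1 + t\<bar> powr q \<le> ((q + 1) * \<bar>t\<bar>) powr q"
    using assms by (intro powr_mono2) auto
  moreover have "0 \<le> 1 + q * t + q\<^sup>2 * t\<^sup>2"
  proof -
    have "1 + q * t + q\<^sup>2 * t\<^sup>2 = (1 + q * t / 2)\<^sup>2 + 3 / 4 * (q * t)\<^sup>2"
      by (simp add: power2_eq_square algebra_simps)
    then show ?thesis by simp
  qed
  ultimately show ?thesis by linarith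
qed

text \<open>For \<open>q = 2\<close> and \<open>a = 0\<close> the middle terms vanish, since \<open>0 powr 0 = 0\<close>.\<close>

lemma powr_add_upper:
  fixes q a x :: real
  assumes "q \<ge> 2"
  shows "\<bar>a + x\<bar> powr q \<le> \<bar>a\<bar> powr q + q * (sgn a * \<bar>a\<bar> powr (q - 1) * x)
    + q\<^sup>2 * (\<bar>a\<bar> powr (q - 2) * x\<^sup>2) + ((q + 1) * \<bar>x\<bar>) powr q"
proof (cases "a = 0")
  case True
  have "\<bar>x\<bar> powr q \<le> ((q + 1) * \<bar>x\<bar>) powr q"
    using assms by (intro powr_mono2) (auto simp: algebra_simps)
  then show ?thesis using True assms by simp
next
  case False
  \<comment> \<open>Both sides scale like \<open>\<bar>a\<bar> powr q\<close>, which reduces the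
    claim to the expansion around 1.\<close>
  define t where "t = x / a"
  have x: "x = a * t" using False by (simp add: t_def)
  have e1: "\<bar>a\<bar> powr q = \<bar>a\<bar> powr (q - 1) * \<bar>a\<bar>"
    using False by (simp add: powr_diff)
  have e2: "\<bar>a\<bar> powr q = \<bar>a\<bar> powr (q - 2) * a\<^sup>2"
    using False by (simp add: powr_diff)
  have "\<bar>a + x\<bar> = \<bar>a\<bar> * \<bar>1 + t\<bar>"
    by (simp add: x flip: abs_mult) (simp add: algebra_simps)
  then have "\<bar>a + x\<bar> powr q = \<bar>a\<bar> powr q * \<bar>1 + t\<bar> powr q"
    by (simp add: powr_mult)
  also have "\<dots> \<le> \<bar>a\<bar> powr q * (1 + q * t + q\<^sup>2 * t\<^sup>2 + ((q + 1) * \<bar>t\<bar>) powr q)"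
    by (intro mult_left_mono powr_one_plus_upper assms) simp
  also have "\<dots> = \<bar>a\<bar> powr q + q * (\<bar>a\<bar> powr q * t) + q\<^sup>2 * (\<bar>a\<bar> powr q * t\<^sup>2)
      + \<bar>a\<bar> powr q * ((q + 1) * \<bar>t\<bar>) powr q"
    by (simp add: algebra_simps)
  also have "\<bar>a\<bar> powr q * t = sgn a * \<bar>a\<bar> powr (q - 1) * x"
    unfolding e1 x by (simp add: abs_sgn[of a])
  also have "\<bar>a\<bar> powr q * t\<^sup>2 = \<bar>a\<bar> powr (q - 2) * x\<^sup>2"
    unfolding e2 x by (simp add: power_mult_distrib)
  also have "\<bar>a\<bar> powr q * ((q + 1) * \<bar>t\<bar>) powr q = ((q + 1) * \<bar>x\<bar>) powr q"
    unfolding x using assms by (simp add: abs_mult powr_mult)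
  finally show ?thesis .
qed

section \<open>Two-point inequalities\<close>

lemma powr_Bernoulli:
  fixes p y :: real
  assumes "p \<ge> 1" "y \<ge> 0"
  shows "1 + p * y \<le> (1 + y) powr p"
proof -
  have "(1 + 0) powr p - p * 0 \<le> (1 + y) powr p - p * y"
  proof (rule DERIV_nonneg_imp_nondecreasing[OF assms(2)])
    fix x :: real assume x: "0 \<le> x"
    show "\<exists>D. ((\<lambda>y. (1 + y) powr p - p * y) has_real_derivative D) (at x) \<and> 0 \<le> D"
      using x assms(1)
      by (intro exI[of _ "p * (1 + x) powr (p - 1) - p"])
        (auto intro!: derivative_eq_intros ge_one_powr_ge_zero)
  qed
  then show ?thesis by simp
qed

text \<open>Convexity handles positive arguments; if one of them is 0, the claim reduces to
  \<open>2 \<le> 2 powr p\<close>.\<close>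

lemma powr_midpoint_convex:
  fixes p x y :: real
  assumes "p \<ge> 1" "x \<ge> 0" "y \<ge> 0"
  shows "2 * ((x + y) / 2) powr p \<le> x powr p + y powr p"
proof -
  have half: "2 * (z / 2) powr p \<le> z powr p" if "z \<ge> 0" for z :: real
  proof -
    have "2 powr 1 \<le> 2 powr p" using assms(1) by (intro powr_mono) auto
    then have "2 * z powr p \<le> 2 powr p * z powr p" by (intro mult_right_mono) auto
    then show ?thesis using that by (simp add: powr_divide field_simps)
  qed
  show ?thesis
  proof (cases "x = 0 \<or> y = 0")
    case True
    then show ?thesis using half assms by auto
  next
    case False
    then have "((1 - 1/2) *\<^sub>R x + (1/2) *\<^sub>R y) powr p \<le> (1 - 1/2) * x powr p + (1/2) * y powr p"
      using assms by (intro convex_onD[OF powr_convex[OF assms(1)]]) auto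
    then show ?thesis by (simp add: field_simps)
  qed
qed

lemma square_powr_half:
  fixes z q :: real
  shows "(z\<^sup>2) powr (q / 2) = \<bar>z\<bar> powr q"
proof -
  have "z\<^sup>2 = \<bar>z\<bar> powr 2" by (cases "z = 0") simp_all
  then show ?thesis by (simp only: powr_powr) simp
qed

text \<open>After division by \<open>\<bar>a\<bar> powr q\<close>, Bernoulli's inequality with
  exponent q/2 bounds the left side by twice (a^2 + s^2)^(q/2); since a^2 + s^2 is the mean of (a +
  s)^2 and (a - s)^2, convexity finishes. This turns a second-order term into an average over
  signs.\<close>

lemma powr_two_point_lower:
  fixes q a s :: real
  assumes "q \<ge> 2"
  shows "2 * \<bar>a\<bar> powr q + q * (\<bar>a\<bar> powr (q - 2) * s\<^sup>2) \<le> \<bar>a + s\<bar> powr q + \<bar>a - s\<bar> powr q"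
proof (cases "a = 0")
  case True
  then show ?thesis using assms by simp
next
  case False
  define p where "p = q / 2"
  have p: "p \<ge> 1" using assms by (simp add: p_def)
  have sq: "(z\<^sup>2) powr p = \<bar>z\<bar> powr q" for z :: real
    by (simp only: p_def square_powr_half)
  have e2: "\<bar>a\<bar> powr q = \<bar>a\<bar> powr (q - 2) * a\<^sup>2"
    using False by (simp add: powr_diff)
  have "2 * \<bar>a\<bar> powr q + q * (\<bar>a\<bar> powr (q - 2) * s\<^sup>2) = 2 * (\<bar>a\<bar> powr q * (1 + p * (s / a)\<^sup>2))"
    unfolding e2 p_def using False by (simp add: field_simps)
  also have "\<dots> \<le> 2 * (\<bar>a\<bar> powr q * (1 + (s / a)\<^sup>2) powr p)"
    by (intro mult_left_mono powr_Bernoulli p) auto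
  also have "\<bar>a\<bar> powr q * (1 + (s / a)\<^sup>2) powr p = (a\<^sup>2 * (1 + (s / a)\<^sup>2)) powr p"
    by (simp add: powr_mult flip: sq)
  also have "a\<^sup>2 * (1 + (s / a)\<^sup>2) = ((a + s)\<^sup>2 + (a - s)\<^sup>2) / 2"
    using False by (simp add: power2_eq_square field_simps)
  also have "2 * \<dots> powr p \<le> ((a + s)\<^sup>2) powr p + ((a - s)\<^sup>2) powr p"
    by (intro powr_midpoint_convex p) auto
  finally show ?thesis unfolding sq .
qed

lemma cosh_le_exp_half_square:
  fixes x :: real
  shows "cosh x \<le> exp (x\<^sup>2 / 2)"
proof -
  have *: "cosh x \<le> exp (x\<^sup>2 / 2)" if "x \<ge> 0" for x :: real
  proof -
    \<comment> \<open>Hoeffding's lemma for a fair coin\<close>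
    have "- (2 * x) * (1/2) + ln (1 + 1/2 * (exp (2 * x) - 1)) \<le> (2 * x)\<^sup>2 / 8"
      using that by (intro Hoeffdings_lemma_aux) auto
    then have "ln ((1 + exp (2 * x)) / 2) \<le> x + x\<^sup>2 / 2"
      by (simp add: field_simps power2_eq_square)
    then have "(1 + exp (2 * x)) / 2 \<le> exp (x + x\<^sup>2 / 2)"
      using ln_le_cancel_iff[of "(1 + exp (2 * x)) / 2" "exp (x + x\<^sup>2 / 2)"]
      by (simp add: add_pos_pos)
    also have "\<dots> = exp x * exp (x\<^sup>2 / 2)" by (simp add: exp_add)
    finally have "exp x * cosh x \<le> exp x * exp (x\<^sup>2 / 2)"
      by (simp add: cosh_def algebra_simps flip: exp_add)
    then show ?thesis by simp
  qed
  from *[of "\<bar>x\<bar>"] show ?thesis by (cases "x \<ge> 0") auto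
qed

lemma powr_two_point_upper:
  fixes p t :: real
  assumes "p \<ge> 0" "\<bar>t\<bar> \<le> 1"
  shows "(1 + t) powr p + (1 - t) powr p \<le> 2 * exp (p\<^sup>2 * t\<^sup>2 / 2)"
proof -
  have le: "(1 + u) powr p \<le> exp (p * u)" if "\<bar>u\<bar> \<le> 1" for u
  proof -
    have "(1 + u) powr p \<le> exp u powr p"
      using that assms exp_ge_add_one_self[of u] by (intro powr_mono2) auto
    then show ?thesis by (simp add: powr_def)
  qed
  have "(1 + t) powr p + (1 - t) powr p \<le> exp (p * t) + exp (p * - t)"
    using le[of t] le[of "- t"] assms(2) by simp
  also have "\<dots> = 2 * cosh (p * t)" by (simp add: cosh_def)
  also have "\<dots> \<le> 2 * exp ((p * t)\<^sup>2 / 2)" by (intro mult_left_mono cosh_le_exp_half_square) auto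
  finally show ?thesis by (simp add: power_mult_distrib)
qed

text \<open>Read U, V, P as |a|^2, |b|^2 and the inner product of vectors a, b: the brackets are |a
  + c b|^2 and |a - c b|^2. Dividing by \<open>A\<close> turns them into 1 + t and 1 - t, and U + V
  into 1 + (1 - c^2) r, while \<open>P\<^sup>2 \<le> U * V\<close> keeps t small.\<close>

lemma two_point_hypercontractive:
  fixes U V P p c :: real
  assumes "U \<ge> 0" "V \<ge> 0" "P\<^sup>2 \<le> U * V" "p \<ge> 1" "c\<^sup>2 = 1 / (8 * p\<^sup>2)"
  shows "(U + 2 * c * P + c\<^sup>2 * V) powr p + (U - 2 * c * P + c\<^sup>2 * V) powr p \<le> 2 * (U + V) powr p"
proof -
  define A where "A = U + c\<^sup>2 * V"
  have c8: "c\<^sup>2 \<le> 1 / 8" unfolding assms(5) using assms(4) by (simp add: field_simps)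
  have c0: "c\<^sup>2 > 0" unfolding assms(5) using assms(4) by simp
  show ?thesis
  proof (cases "A = 0")
    case True
    have "0 \<le> c\<^sup>2 * V" using assms by simp
    then have "U = 0" "c\<^sup>2 * V = 0" using True assms(1) unfolding A_def by linarith+
    then show ?thesis using c0 assms(3) by simp
  next
    case False
    then have A: "A > 0" using assms(1,2) c0 by (simp add: A_def order_less_le)
    define t where "t = 2 * c * P / A"
    define r where "r = V / A"
    have V: "V = r * A" and r: "r \<ge> 0" using A assms by (auto simp: r_def)
    have U: "U = (1 - c\<^sup>2 * r) * A"
      unfolding left_diff_distrib mult.assoc V[symmetric] by (simp add: A_def)
    have cr: "c\<^sup>2 * r \<le> 1" using U assms(1) A by (simp add: zero_le_mult_iff)
    have "t\<^sup>2 * A\<^sup>2 = 4 * c\<^sup>2 * P\<^sup>2" using A by (simp add: t_def power_divide power_mult_distrib)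
    also have "\<dots> \<le> 4 * c\<^sup>2 * (U * V)" using assms(3) by (intro mult_left_mono) auto
    also have "\<dots> = (4 * c\<^sup>2 * r * (1 - c\<^sup>2 * r)) * A\<^sup>2" by (simp add: U V power2_eq_square)
    finally have t2: "t\<^sup>2 \<le> 4 * c\<^sup>2 * r * (1 - c\<^sup>2 * r)" using A by simp
    \<comment> \<open>4 u (1 - u) is at most 1 for every u, which keeps 1 + t and 1 - t
      nonnegative.\<close>
    have "4 * c\<^sup>2 * r * (1 - c\<^sup>2 * r) = 1 - (1 - 2 * (c\<^sup>2 * r))\<^sup>2"
      by (simp add: power2_eq_square algebra_simps)
    then have t1: "\<bar>t\<bar> \<le> 1" using t2 by (simp flip: abs_square_le_1) (smt (verit) zero_le_power2)
    \<comment> \<open>With \<open>U + V = A (1 + y)\<close>: for \<open>y \<ge> 1\<close> the bound \<open>\<bar>t\<bar> \<le> 1\<close> suffices; otherwise use \<open>cosh x \<le> exp (x\<^sup>2/2)\<close>.\<close>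
    have main: "(1 + t) powr p + (1 - t) powr p \<le> 2 * (1 + (1 - c\<^sup>2) * r) powr p"
    proof (cases "(1 - c\<^sup>2) * r \<ge> 1")
      case True
      have "(1 + t) powr p \<le> (1 + (1 - c\<^sup>2) * r) powr p" "(1 - t) powr p \<le> (1 + (1 - c\<^sup>2) * r) powr p"
        using t1 True assms(4) by (intro powr_mono2; linarith)+
      then show ?thesis by simp
    next
      case False
      define y where "y = (1 - c\<^sup>2) * r"
      have y: "0 \<le> y" "y \<le> 1" using False r c8 by (auto simp: y_def)
      \<comment> \<open>Here p c^2 = 1/(8 p) \<le> 1/8 gives r/4, 1 - c^2 \<ge> 1/2 turns this into
        y/2, and y \<le> 1 allows the last step. The target y/(1 + y) is at most ln (1 + y), so
        multiplying by p and exponentiating yields (1 + y)^p.\<close>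
      have "p * t\<^sup>2 / 2 \<le> y / (1 + y)"
      proof -
        have "t\<^sup>2 \<le> 4 * c\<^sup>2 * r * 1"
          using t2 mult_left_mono[of "1 - c\<^sup>2 * r" 1 "4 * c\<^sup>2 * r"] r by simp
        then have "p * t\<^sup>2 / 2 \<le> 2 * (p * c\<^sup>2) * r" using assms(4) by simp
        also have "p * c\<^sup>2 \<le> 1 / 8" unfolding assms(5) using assms(4) by (simp add: field_simps power2_eq_square)
        then have "2 * (p * c\<^sup>2) * r \<le> 1 / 4 * r" using r by (intro mult_right_mono) auto
        also have "\<dots> \<le> y / 2" 
          using mult_right_mono[of "1/2" "1 - c\<^sup>2" r] c8 r by (simp add: y_def)
        also have "\<dots> \<le> y / (1 + y)" using y by (intro divide_left_mono) auto
        finally show ?thesis .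
      qed
      also have "\<dots> \<le> ln (1 + y)"
      proof -
        have "- ln (1 + y) \<le> inverse (1 + y) - 1"
          using y ln_le_minus_one[of "inverse (1 + y)"] by (simp add: ln_inverse)
        also have "\<dots> = - (y / (1 + y))" using y by (simp add: field_simps)
        finally show ?thesis by simp
      qed
      finally have "p * (p * t\<^sup>2 / 2) \<le> p * ln (1 + y)" using assms(4) by (intro mult_left_mono) auto
      then have "exp (p\<^sup>2 * t\<^sup>2 / 2) \<le> (1 + y) powr p"
        using y by (simp add: powr_def power2_eq_square)
      then show ?thesis
        using powr_two_point_upper[of p t] t1 assms(4) by (simp add: y_def)
    qed
    have e: "U + 2 * c * P + c\<^sup>2 * V = A * (1 + t)" "U - 2 * c * P + c\<^sup>2 * V = A * (1 - t)"
      using A by (simp_all add: A_def t_def field_simps)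
    have e3: "U + V = A * (1 + (1 - c\<^sup>2) * r)" by (simp add: U V algebra_simps)
    have "1 + (1 - c\<^sup>2) * r \<ge> 0" using c8 r by simp
    then show ?thesis unfolding e e3 powr_mult
      using mult_left_mono[OF main, of "A powr p"] by (simp add: algebra_simps)
  qed
qed

text \<open>The product is at most the q-th power of the larger of x and y. This supplies integrable
  majorants for mixed powers.\<close>

lemma powr_mult_powr_le_add:
  fixes x y q e :: real
  assumes "0 \<le> e" "e \<le> q" "0 \<le> x" "0 \<le> y"
  shows "x powr (q - e) * y powr e \<le> x powr q + y powr q"
proof (cases "y \<le> x")
  case True
  then have "x powr (q - e) * y powr e \<le> x powr (q - e) * x powr e"
    using assms by (intro mult_left_mono powr_mono2) auto
  also have "\<dots> = x powr q" by (simp flip: powr_add)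
  finally show ?thesis by (simp add: add_increasing2)
next
  case False
  then have "x powr (q - e) * y powr e \<le> y powr (q - e) * y powr e"
    using assms by (intro mult_right_mono powr_mono2) auto
  also have "\<dots> = y powr q" by (simp flip: powr_add)
  finally show ?thesis by (simp add: add_increasing)
qed

lemma sum_Pow_insert:
  assumes "finite J" "i \<notin> J"
  shows "sum f (Pow (insert i J)) = sum f (Pow J) + (\<Sum>S\<in>Pow J. f (insert i S))"
proof -
  have "inj_on (insert i) (Pow J)" using assms(2) by (auto simp: inj_on_def)
  then show ?thesis unfolding Pow_insert using assms
    by (subst sum.union_disjoint) (auto simp: sum.reindex)
qed

subsection \<open>Multilinear polynomials in independent variables\<close>

text \<open>Index set and point are arguments of their own: the induction removes one index, and
  independence treats the polynomial as a function on the product space over \<open>J\<close>. With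
  r = \<rho> it gives the noise operator, with r = 1 the polynomial itself.\<close>

definition chaos :: "'i set \<Rightarrow> real \<Rightarrow> ('i set \<Rightarrow> real) \<Rightarrow> ('i \<Rightarrow> real) \<Rightarrow> real" where
  "chaos J r a z = (\<Sum>S\<in>Pow J. r ^ card S * a S * (\<Prod>i\<in>S. z i))"

text \<open>Each subset containing i contributes one factor r z_i, which comes out in front; both
  inductions split off a variable this way.\<close>

lemma chaos_insert:
  assumes "finite J" "i \<notin> J"
  shows "chaos (insert i J) r a z = chaos J r a z + r * z i * chaos J r (\<lambda>S. a (insert i S)) z"
proof -
  have "r ^ card (insert i S) * a (insert i S) * prod z (insert i S)
      = r * z i * (r ^ card S * a (insert i S) * prod z S)" if "S \<in> Pow J" for S
  proof -
    have "finite S" "i \<notin> S" using that assms finite_subset by auto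
    then show ?thesis by simp
  qed
  then have "(\<Sum>S\<in>Pow J. r ^ card (insert i S) * a (insert i S) * prod z (insert i S))
      = (\<Sum>S\<in>Pow J. r * z i * (r ^ card S * a (insert i S) * prod z S))"
    by (rule sum.cong[OF refl])
  then show ?thesis
    using assms by (simp add: chaos_def sum_Pow_insert sum_distrib_left del: mult_cancel_left)
qed

text \<open>Makes G + c H and G - c H polynomials in the same variables, so that the induction
  hypothesis covers them.\<close>

lemma chaos_add_scaled:
  "chaos J r (\<lambda>S. a S + c * b S) z = chaos J r a z + c * chaos J r b z"
  by (simp add: chaos_def sum_distrib_left sum.distrib algebra_simps)

text \<open>Only coordinates in \<open>J\<close> matter, the form in which independence of the
  blocks \<open>J\<close> and \<open>{i}\<close> is applied.\<close>

lemma chaos_restrict: "chaos J r a (restrict z J) = chaos J r a z"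
  unfolding chaos_def by (intro sum.cong arg_cong2[where f = "(*)"] prod.cong) auto

lemma measurable_chaos [measurable]:
  "chaos J r a \<in> borel_measurable (PiM J (\<lambda>_. borel))"
  unfolding chaos_def
  by (intro borel_measurable_sum borel_measurable_times borel_measurable_const borel_measurable_prod
      measurable_component_singleton) auto

section \<open>Squared derivative norms in terms of coefficients\<close>

text \<open>By orthonormality this is \<open>\<parallel>D\<^sub>S f\<parallel>\<^sub>2\<^sup>2\<close> for the polynomial \<open>f\<close> with coefficients \<open>a\<close>.\<close>

definition tail_weight :: "'i set \<Rightarrow> 'i set \<Rightarrow> ('i set \<Rightarrow> real) \<Rightarrow> real" where
  "tail_weight J S a = (\<Sum>T\<in>Pow (J - S). (a (S \<union> T))\<^sup>2)"

lemma tail_weight_nonneg: "0 \<le> tail_weight J S a"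
  by (simp add: tail_weight_def sum_nonneg)

lemma tail_weight_insert:
  assumes "finite J" "i \<notin> J" "S \<subseteq> J"
  shows "tail_weight (insert i J) S a = tail_weight J S a + tail_weight J S (\<lambda>S. a (insert i S))"
    and "tail_weight (insert i J) (insert i S) a = tail_weight J S (\<lambda>S. a (insert i S))"
proof -
  have "insert i J - S = insert i (J - S)" "insert i J - insert i S = J - S"
    using assms by auto
  then show "tail_weight (insert i J) S a = tail_weight J S a + tail_weight J S (\<lambda>S. a (insert i S))"
    "tail_weight (insert i J) (insert i S) a = tail_weight J S (\<lambda>S. a (insert i S))"
    using assms by (simp_all add: tail_weight_def sum_Pow_insert)
qed

lemma tail_weight_add_scaled:
  "tail_weight J S (\<lambda>S. a S + c * b S) = tail_weight J S a
    + 2 * c * (\<Sum>T\<in>Pow (J - S). a (S \<union> T) * b (S \<union> T)) + c\<^sup>2 * tail_weight J S b"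
  by (simp add: tail_weight_def sum_distrib_left algebra_simps power2_eq_square flip: sum.distrib)

text \<open>The cross term is the inner product of the two tails, and Cauchy-Schwarz gives the
  condition on P in the two-point inequality.\<close>

lemma tail_weight_two_point:
  assumes "p \<ge> 1" "c\<^sup>2 = 1 / (8 * p\<^sup>2)"
  shows "tail_weight J S (\<lambda>S. a S + c * b S) powr p + tail_weight J S (\<lambda>S. a S + (- c) * b S) powr p
    \<le> 2 * (tail_weight J S a + tail_weight J S b) powr p"
  unfolding tail_weight_add_scaled
  using two_point_hypercontractive[OF tail_weight_nonneg tail_weight_nonneg
      Cauchy_Schwarz_ineq_sum[of "\<lambda>T. a (S \<union> T)" "\<lambda>T. b (S \<union> T)" "Pow (J - S)", folded tail_weight_def]
      assms(1,2)]
  by simp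

section \<open>Independence and second moments\<close>

context prob_space
begin

text \<open>The blocks \<open>J\<close> and \<open>{i}\<close> of an independent family are
  independent, hence so are functions of them; \<open>restr\<close> says that \<open>\<phi>\<close>
  reads only the coordinates in \<open>J\<close>.\<close>

lemma indep_vars_split:
  fixes Z :: "'i \<Rightarrow> 'a \<Rightarrow> real" and \<phi> :: "('i \<Rightarrow> real) \<Rightarrow> real" and \<psi> :: "real \<Rightarrow> real"
  assumes ind: "indep_vars (\<lambda>_. borel) Z I" and J: "J \<subseteq> I" "i \<in> I" "i \<notin> J"
    and [measurable]: "\<phi> \<in> borel_measurable (PiM J (\<lambda>_. borel))" "\<psi> \<in> borel_measurable borel"
    and restr: "\<And>z. \<phi> (restrict z J) = \<phi> z"
    and int: "integrable M (\<lambda>\<omega>. \<phi> (\<lambda>i. Z i \<omega>))" "integrable M (\<lambda>\<omega>. \<psi> (Z i \<omega>))"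
  shows indep_vars_split_integrable: "integrable M (\<lambda>\<omega>. \<phi> (\<lambda>i. Z i \<omega>) * \<psi> (Z i \<omega>))"
    and indep_vars_split_integral:
      "(\<integral>\<omega>. \<phi> (\<lambda>i. Z i \<omega>) * \<psi> (Z i \<omega>) \<partial>M) = (\<integral>\<omega>. \<phi> (\<lambda>i. Z i \<omega>) \<partial>M) * (\<integral>\<omega>. \<psi> (Z i \<omega>) \<partial>M)"
proof -
  have "indep_var borel (\<phi> \<circ> (\<lambda>\<omega>. restrict (\<lambda>i. Z i \<omega>) J))
      borel ((\<lambda>z. \<psi> (z i)) \<circ> (\<lambda>\<omega>. restrict (\<lambda>i. Z i \<omega>) {i}))"
    by (rule indep_var_compose[OF indep_var_restrict[OF ind]]) (use J in auto)
  then have *: "indep_var borel (\<lambda>\<omega>. \<phi> (\<lambda>i. Z i \<omega>)) borel (\<lambda>\<omega>. \<psi> (Z i \<omega>))"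
    by (simp add: comp_def restr)
  show "integrable M (\<lambda>\<omega>. \<phi> (\<lambda>i. Z i \<omega>) * \<psi> (Z i \<omega>))"
    by (rule indep_var_integrable[OF * int])
  show "(\<integral>\<omega>. \<phi> (\<lambda>i. Z i \<omega>) * \<psi> (Z i \<omega>) \<partial>M) = (\<integral>\<omega>. \<phi> (\<lambda>i. Z i \<omega>) \<partial>M) * (\<integral>\<omega>. \<psi> (Z i \<omega>) \<partial>M)"
    by (rule indep_var_lebesgue_integral[OF * int])
qed

lemma random_variable_chaos:
  assumes "indep_vars (\<lambda>_. borel) Z I" "J \<subseteq> I"
  shows "random_variable borel (\<lambda>\<omega>. chaos J r a (\<lambda>i. Z i \<omega>))"
  unfolding chaos_def using assms
  by (intro borel_measurable_sum borel_measurable_times borel_measurable_const borel_measurable_prod)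
    (auto simp: indep_vars_def)

text \<open>\<open>\<bar>x\<bar> ^ k \<le> 1 + \<bar>x\<bar> powr q\<close>, so a finite q-th moment
  makes each variable and its square integrable.\<close>

lemma integrable_powr_imp_integrable_power:
  fixes X :: "'a \<Rightarrow> real"
  assumes [measurable]: "random_variable borel X" and int: "integrable M (\<lambda>\<omega>. \<bar>X \<omega>\<bar> powr q)"
    and k: "k > 0" "real k \<le> q"
  shows "integrable M (\<lambda>\<omega>. X \<omega> ^ k)"
proof (rule Bochner_Integration.integrable_bound)
  show "integrable M (\<lambda>\<omega>. 1 + \<bar>X \<omega>\<bar> powr q)" using int by simp
  have "\<bar>x\<bar> ^ k \<le> 1 + \<bar>x\<bar> powr q" for x :: real
  proof (cases "x = 0")
    case False
    then show ?thesis
      using powr_mult_powr_le_add[of "real k" q 1 "\<bar>x\<bar>"] k by (simp add: powr_realpow)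
  qed (use k in \<open>simp add: power_0_left\<close>)
  then show "AE \<omega> in M. norm (X \<omega> ^ k) \<le> norm (1 + \<bar>X \<omega>\<bar> powr q)"
    by (simp add: power_abs)
qed simp

text \<open>Orthonormality of the monomials, by induction: in (G + Z_i H)^2 the cross term has mean
  0 and Z_i^2 contributes a factor 1. Applied to the variables outside S, this evaluates the norm of
  D_S f.\<close>

lemma chaos_second_moment:
  fixes Z :: "'i \<Rightarrow> 'a \<Rightarrow> real"
  assumes ind: "indep_vars (\<lambda>_. borel) Z I"
    and int: "\<And>i. i \<in> I \<Longrightarrow> integrable M (Z i)" "\<And>i. i \<in> I \<Longrightarrow> integrable M (\<lambda>\<omega>. (Z i \<omega>)\<^sup>2)"
    and mean: "\<And>i. i \<in> I \<Longrightarrow> expectation (Z i) = 0"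
    and var: "\<And>i. i \<in> I \<Longrightarrow> expectation (\<lambda>\<omega>. (Z i \<omega>)\<^sup>2) = 1"
    and "finite J" "J \<subseteq> I"
  shows "integrable M (\<lambda>\<omega>. (chaos J 1 a (\<lambda>i. Z i \<omega>))\<^sup>2) \<and>
    expectation (\<lambda>\<omega>. (chaos J 1 a (\<lambda>i. Z i \<omega>))\<^sup>2) = (\<Sum>T\<in>Pow J. (a T)\<^sup>2)"
  using assms(6,7)
proof (induction J arbitrary: a rule: finite_induct)
  case empty
  then show ?case by (simp add: chaos_def prob_space)
next
  case (insert i J)
  define G where "G = chaos J 1 a"
  define H where "H = chaos J 1 (\<lambda>S. a (insert i S))"
  let ?Z = "\<lambda>\<omega> i. Z i \<omega>"
  have J: "J \<subseteq> I" "i \<in> I" "i \<notin> J" using insert by auto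
  have restr: "G (restrict z J) = G z" "H (restrict z J) = H z" for z
    by (simp_all add: G_def H_def chaos_restrict)
  have [measurable]: "G \<in> borel_measurable (PiM J (\<lambda>_. borel))" "H \<in> borel_measurable (PiM J (\<lambda>_. borel))"
    by (simp_all add: G_def H_def)
  have m: "(\<lambda>z. G z * H z) \<in> borel_measurable (PiM J (\<lambda>_. borel))"
    "(\<lambda>z. (H z)\<^sup>2) \<in> borel_measurable (PiM J (\<lambda>_. borel))"
    "(\<lambda>x::real. x) \<in> borel_measurable borel" "(\<lambda>x::real. x\<^sup>2) \<in> borel_measurable borel"
    by measurable
  have [measurable]: "random_variable borel (\<lambda>\<omega>. G (?Z \<omega>))" "random_variable borel (\<lambda>\<omega>. H (?Z \<omega>))"
    unfolding G_def H_def by (rule random_variable_chaos[OF ind J(1)])+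
  have G: "integrable M (\<lambda>\<omega>. (G (?Z \<omega>))\<^sup>2)"
    "expectation (\<lambda>\<omega>. (G (?Z \<omega>))\<^sup>2) = (\<Sum>T\<in>Pow J. (a T)\<^sup>2)"
    and H: "integrable M (\<lambda>\<omega>. (H (?Z \<omega>))\<^sup>2)"
    "expectation (\<lambda>\<omega>. (H (?Z \<omega>))\<^sup>2) = (\<Sum>T\<in>Pow J. (a (insert i T))\<^sup>2)"
    using insert.IH J unfolding G_def H_def by auto
  have GH: "integrable M (\<lambda>\<omega>. G (?Z \<omega>) * H (?Z \<omega>))"
  proof (rule Bochner_Integration.integrable_bound)
    show "integrable M (\<lambda>\<omega>. (G (?Z \<omega>))\<^sup>2 + (H (?Z \<omega>))\<^sup>2)" using G H by simp
    have "\<bar>x * y\<bar> \<le> x\<^sup>2 + y\<^sup>2" for x y :: real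
    proof -
      have "2 * (\<bar>x\<bar> * \<bar>y\<bar>) \<le> x\<^sup>2 + y\<^sup>2"
        using sum_squares_bound[of "\<bar>x\<bar>" "\<bar>y\<bar>"] by (simp add: mult.assoc)
      moreover have "0 \<le> \<bar>x\<bar> * \<bar>y\<bar>" by simp
      ultimately show ?thesis unfolding abs_mult by linarith
    qed
    then show "AE \<omega> in M. norm (G (?Z \<omega>) * H (?Z \<omega>)) \<le> norm ((G (?Z \<omega>))\<^sup>2 + (H (?Z \<omega>))\<^sup>2)"
      by simp
  qed simp
  have restr2: "G (restrict z J) * H (restrict z J) = G z * H z" "(H (restrict z J))\<^sup>2 = (H z)\<^sup>2" for z
    by (simp_all only: restr)
  note s1 = indep_vars_split[OF ind J m(1,3) restr2(1) GH int(1)[OF J(2)]]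
  note s2 = indep_vars_split[OF ind J m(2,4) restr2(2) H(1) int(2)[OF J(2)]]
  have eq: "(chaos (insert i J) 1 a (?Z \<omega>))\<^sup>2
      = (G (?Z \<omega>))\<^sup>2 + 2 * (G (?Z \<omega>) * H (?Z \<omega>) * Z i \<omega>) + (H (?Z \<omega>))\<^sup>2 * (Z i \<omega>)\<^sup>2" for \<omega>
    by (simp add: chaos_insert[OF insert.hyps] G_def H_def power2_eq_square algebra_simps)
  show ?case unfolding eq
    using s1 s2 G H mean[OF J(2)] var[OF J(2)]
    by (simp add: sum_Pow_insert[OF insert.hyps])
qed

end

text \<open>The right-hand side of the theorem when s = \<sigma>^(2 - q) and p = q/2, since the tail
  weight of S is then raised to the q-th power of the norm of D_S f.\<close>

definition weight_sum :: "real \<Rightarrow> real \<Rightarrow> 'i set \<Rightarrow> ('i set \<Rightarrow> real) \<Rightarrow> real" where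
  "weight_sum s p J a = (\<Sum>S\<in>Pow J. s ^ card S * tail_weight J S a powr p)"

text \<open>Sets without i collect both tail weights; each set with i carries an extra s and sees
  only the coefficients involving i. The two summands match the main part and the remainder in the
  induction.\<close>

lemma weight_sum_insert:
  assumes "finite J" "i \<notin> J"
  shows "weight_sum s p (insert i J) a
    = (\<Sum>S\<in>Pow J. s ^ card S * (tail_weight J S a + tail_weight J S (\<lambda>S. a (insert i S))) powr p)
      + s * weight_sum s p J (\<lambda>S. a (insert i S))"
proof -
  have "s ^ card (insert i S) * tail_weight (insert i J) (insert i S) a powr p
      = s * (s ^ card S * tail_weight J S (\<lambda>S. a (insert i S)) powr p)" if "S \<in> Pow J" for S
  proof -
    have "finite S" "i \<notin> S" using that assms finite_subset by auto
    then show ?thesis using that assms by (simp add: tail_weight_insert)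
  qed
  then have "(\<Sum>S\<in>Pow J. s ^ card (insert i S) * tail_weight (insert i J) (insert i S) a powr p)
      = (\<Sum>S\<in>Pow J. s * (s ^ card S * tail_weight J S (\<lambda>S. a (insert i S)) powr p))"
    by (rule sum.cong[OF refl])
  then show ?thesis
    using assms by (simp add: weight_sum_def sum_Pow_insert sum_distrib_left tail_weight_insert)
qed

lemma weight_sum_nonneg: "0 \<le> s \<Longrightarrow> 0 \<le> weight_sum s p J a"
  by (simp add: weight_sum_def sum_nonneg)

text \<open>The two-point inequality holds term by term. It merges the bounds for a + c b and a - c
  b into twice the first summand of \<open>weight_sum_insert\<close>.\<close>

lemma weight_sum_two_point:
  assumes "s \<ge> 0" "p \<ge> 1" "c\<^sup>2 = 1 / (8 * p\<^sup>2)"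
  shows "weight_sum s p J (\<lambda>S. a S + c * b S) + weight_sum s p J (\<lambda>S. a S + (- c) * b S)
    \<le> 2 * (\<Sum>S\<in>Pow J. s ^ card S * (tail_weight J S a + tail_weight J S b) powr p)"
  unfolding weight_sum_def sum_distrib_left sum.distrib[symmetric]
proof (rule sum_mono)
  fix S
  show "s ^ card S * tail_weight J S (\<lambda>S. a S + c * b S) powr p
      + s ^ card S * tail_weight J S (\<lambda>S. a S + (- c) * b S) powr p
    \<le> 2 * (s ^ card S * (tail_weight J S a + tail_weight J S b) powr p)"
    using mult_left_mono[OF tail_weight_two_point[OF assms(2,3), of J S a b], of "s ^ card S"] assms(1)
    by (simp only: distrib_left mult.left_commute[of "s ^ card S" 2] zero_le_power)
qed

section \<open>Moment bound by induction on the variables\<close>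

context prob_space
begin

text \<open>The conditions on r keep the second-order coefficient within what the two-point
  inequalities absorb and the remainder coefficient at most 1. The coefficients vary in the
  induction, whose hypothesis is applied to a, b, a + c b and a - c b; integrability travels along
  to justify domination and factoring.\<close>

lemma chaos_moment_le_weight_sum:
  fixes Z :: "'i \<Rightarrow> 'a \<Rightarrow> real"
  assumes ind: "indep_vars (\<lambda>_. borel) Z I"
    and q: "q \<ge> 2" and s: "s \<ge> 0"
    and int: "\<And>i. i \<in> I \<Longrightarrow> integrable M (\<lambda>\<omega>. \<bar>Z i \<omega>\<bar> powr q)"
    and mean: "\<And>i. i \<in> I \<Longrightarrow> expectation (Z i) = 0"
    and var: "\<And>i. i \<in> I \<Longrightarrow> expectation (\<lambda>\<omega>. (Z i \<omega>)\<^sup>2) = 1"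
    and mom: "\<And>i. i \<in> I \<Longrightarrow> expectation (\<lambda>\<omega>. \<bar>Z i \<omega>\<bar> powr q) \<le> s"
    and r: "r \<ge> 0" "q\<^sup>2 * r\<^sup>2 \<le> 1 / (4 * q)" "(q + 1) * r \<le> 1"
    and "finite J" "J \<subseteq> I"
  shows "integrable M (\<lambda>\<omega>. \<bar>chaos J r a (\<lambda>i. Z i \<omega>)\<bar> powr q) \<and>
    expectation (\<lambda>\<omega>. \<bar>chaos J r a (\<lambda>i. Z i \<omega>)\<bar> powr q) \<le> weight_sum s (q / 2) J a"
  using assms(11,12)
proof (induction J arbitrary: a rule: finite_induct)
  case empty
  show ?case by (simp add: chaos_def prob_space weight_sum_def tail_weight_def square_powr_half)
next
  case (insert i J)
  define b where "b = (\<lambda>S. a (insert i S))"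
  define G where "G = chaos J r a"
  define H where "H = chaos J r b"
  \<comment> \<open>This c satisfies q c^2/2 = 1/(4 q), the bound on q^2 r^2, and c^2 = 1/(8 p^2)
    for p = q/2.\<close>
  define c where "c = 1 / (sqrt 2 * q)"
  have c: "c\<^sup>2 = 1 / (8 * (q / 2)\<^sup>2)" by (simp add: c_def power_divide power_mult_distrib)
  let ?Z = "\<lambda>\<omega> i. Z i \<omega>"
  have J: "J \<subseteq> I" "i \<in> I" "i \<notin> J" using insert by auto
  have restr: "G (restrict z J) = G z" "H (restrict z J) = H z" for z
    by (simp_all add: G_def H_def chaos_restrict)
  have [measurable]: "G \<in> borel_measurable (PiM J (\<lambda>_. borel))" "H \<in> borel_measurable (PiM J (\<lambda>_. borel))"
    by (simp_all add: G_def H_def)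
  \<comment> \<open>The factors depending on \<open>J\<close> alone in the linear term, the
    quadratic term and the remainder; their partners are Z_i, its square and |Z_i|^q.\<close>
  define A1 where "A1 = (\<lambda>z. sgn (G z) * \<bar>G z\<bar> powr (q - 1) * H z)"
  define A2 where "A2 = (\<lambda>z. \<bar>G z\<bar> powr (q - 2) * (H z)\<^sup>2)"
  define A3 where "A3 = (\<lambda>z. \<bar>H z\<bar> powr q)"
  have meas: "A1 \<in> borel_measurable (PiM J (\<lambda>_. borel))" "A2 \<in> borel_measurable (PiM J (\<lambda>_. borel))"
    "A3 \<in> borel_measurable (PiM J (\<lambda>_. borel))"
    unfolding A1_def A2_def A3_def by measurable
  have [measurable]: "random_variable borel (\<lambda>\<omega>. G (?Z \<omega>))" "random_variable borel (\<lambda>\<omega>. H (?Z \<omega>))"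
    unfolding G_def H_def by (rule random_variable_chaos[OF ind J(1)])+
  have [measurable]: "random_variable borel (Z i)" using ind J(2) by (simp add: indep_vars_def)
  have IH: "integrable M (\<lambda>\<omega>. \<bar>chaos J r d (?Z \<omega>)\<bar> powr q)"
    "expectation (\<lambda>\<omega>. \<bar>chaos J r d (?Z \<omega>)\<bar> powr q) \<le> weight_sum s (q / 2) J d" for d
    using insert.IH J(1) by auto
  have G: "integrable M (\<lambda>\<omega>. \<bar>G (?Z \<omega>)\<bar> powr q)"
    and H: "integrable M (\<lambda>\<omega>. \<bar>H (?Z \<omega>)\<bar> powr q)"
    unfolding G_def H_def by (rule IH)+
  have Z1: "integrable M (Z i)" and Z2: "integrable M (\<lambda>\<omega>. (Z i \<omega>)\<^sup>2)"
    using integrable_powr_imp_integrable_power[of "Z i" q 1] integrable_powr_imp_integrable_power[of "Z i" q 2]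
      int[OF J(2)] q by auto
  have restrA: "A1 (restrict z J) = A1 z" "A2 (restrict z J) = A2 z" "A3 (restrict z J) = A3 z" for z
    by (simp_all add: A1_def A2_def A3_def restr)
  have GH: "integrable M (\<lambda>\<omega>. \<bar>G (?Z \<omega>)\<bar> powr q + \<bar>H (?Z \<omega>)\<bar> powr q)" using G H by simp
  have A1: "integrable M (\<lambda>\<omega>. A1 (?Z \<omega>))"
  proof (rule Bochner_Integration.integrable_bound[OF GH])
    have "\<bar>A1 z\<bar> \<le> \<bar>G z\<bar> powr q + \<bar>H z\<bar> powr q" for z
    proof -
      have "\<bar>A1 z\<bar> \<le> 1 * \<bar>G z\<bar> powr (q - 1) * \<bar>H z\<bar>"
        unfolding A1_def abs_mult by (intro mult_right_mono) (auto simp: sgn_if)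
      also have "\<dots> = \<bar>G z\<bar> powr (q - 1) * \<bar>H z\<bar> powr 1"
        by (simp only: powr_one[OF abs_ge_zero] mult_1)
      also have "\<dots> \<le> \<bar>G z\<bar> powr q + \<bar>H z\<bar> powr q"
        using q by (intro powr_mult_powr_le_add) auto
      finally show ?thesis .
    qed
    then show "AE \<omega> in M. norm (A1 (?Z \<omega>)) \<le> norm (\<bar>G (?Z \<omega>)\<bar> powr q + \<bar>H (?Z \<omega>)\<bar> powr q)" by simp
  qed (simp add: A1_def)
  have A2: "integrable M (\<lambda>\<omega>. A2 (?Z \<omega>))"
  proof (rule Bochner_Integration.integrable_bound[OF GH])
    have "\<bar>A2 z\<bar> \<le> \<bar>G z\<bar> powr q + \<bar>H z\<bar> powr q" for z
    proof -
      have "\<bar>A2 z\<bar> = \<bar>G z\<bar> powr (q - 2) * \<bar>H z\<bar> powr 2"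
        by (cases "H z = 0") (simp_all add: A2_def abs_mult)
      also have "\<dots> \<le> \<bar>G z\<bar> powr q + \<bar>H z\<bar> powr q"
        using q by (intro powr_mult_powr_le_add) auto
      finally show ?thesis .
    qed
    then show "AE \<omega> in M. norm (A2 (?Z \<omega>)) \<le> norm (\<bar>G (?Z \<omega>)\<bar> powr q + \<bar>H (?Z \<omega>)\<bar> powr q)" by simp
  qed (simp add: A2_def)
  have A3: "integrable M (\<lambda>\<omega>. A3 (?Z \<omega>))" using H by (simp add: A3_def)
  have m: "(\<lambda>x::real. x) \<in> borel_measurable borel" "(\<lambda>x::real. x\<^sup>2) \<in> borel_measurable borel"
    "(\<lambda>x::real. \<bar>x\<bar> powr q) \<in> borel_measurable borel" by measurable
  note P1 = indep_vars_split[OF ind J meas(1) m(1) restrA(1) A1 Z1]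
  note P2 = indep_vars_split[OF ind J meas(2) m(2) restrA(2) A2 Z2]
  note P3 = indep_vars_split[OF ind J meas(3) m(3) restrA(3) A3 int[OF J(2)]]
  define F where "F = (\<lambda>\<omega>. chaos (insert i J) r a (?Z \<omega>))"
  \<comment> \<open>The pointwise majorant from \<open>powr_add_upper\<close> at G with increment r
    Z_i H, arranged so that independence factors its last three summands.\<close>
  define B where "B = (\<lambda>\<omega>. \<bar>G (?Z \<omega>)\<bar> powr q + q * r * (A1 (?Z \<omega>) * Z i \<omega>)
    + q\<^sup>2 * r\<^sup>2 * (A2 (?Z \<omega>) * (Z i \<omega>)\<^sup>2) + ((q + 1) * r) powr q * (A3 (?Z \<omega>) * \<bar>Z i \<omega>\<bar> powr q))"
  have FB: "\<bar>F \<omega>\<bar> powr q \<le> B \<omega>" for \<omega>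
  proof -
    have F: "F \<omega> = G (?Z \<omega>) + r * Z i \<omega> * H (?Z \<omega>)"
      by (simp add: F_def G_def H_def b_def chaos_insert[OF insert.hyps])
    have "((q + 1) * \<bar>r * Z i \<omega> * H (?Z \<omega>)\<bar>) powr q
        = ((q + 1) * r) powr q * (A3 (?Z \<omega>) * \<bar>Z i \<omega>\<bar> powr q)"
      using q r(1) by (simp add: abs_mult powr_mult A3_def)
    then show ?thesis
      using powr_add_upper[OF q, of "G (?Z \<omega>)" "r * Z i \<omega> * H (?Z \<omega>)"]
      unfolding F B_def A1_def A2_def by (simp add: power_mult_distrib mult_ac)
  qed
  have intB: "integrable M B"
    unfolding B_def using G P1(1) P2(1) P3(1) by (intro Bochner_Integration.integrable_add) simp_all
  have "random_variable borel F"
    unfolding F_def by (rule random_variable_chaos[OF ind insert.prems])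
  then have intF: "integrable M (\<lambda>\<omega>. \<bar>F \<omega>\<bar> powr q)"
  proof (intro Bochner_Integration.integrable_bound[OF intB])
    show "AE \<omega> in M. norm (\<bar>F \<omega>\<bar> powr q) \<le> norm (B \<omega>)"
      using FB by (intro AE_I2) (metis abs_ge_self order_trans powr_ge_zero real_norm_def abs_of_nonneg)
  qed measurable
  \<comment> \<open>The quadratic term is absorbed by averaging |G + c H|^q and |G - c H|^q, to
    which the induction hypothesis applies.\<close>
  have "2 * expectation (\<lambda>\<omega>. \<bar>G (?Z \<omega>)\<bar> powr q) + q * c\<^sup>2 * expectation (\<lambda>\<omega>. A2 (?Z \<omega>))
      = expectation (\<lambda>\<omega>. 2 * \<bar>G (?Z \<omega>)\<bar> powr q + q * c\<^sup>2 * A2 (?Z \<omega>))"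
    using G A2 by simp
  also have "\<dots> \<le> expectation (\<lambda>\<omega>. \<bar>chaos J r (\<lambda>S. a S + c * b S) (?Z \<omega>)\<bar> powr q
      + \<bar>chaos J r (\<lambda>S. a S + (- c) * b S) (?Z \<omega>)\<bar> powr q)"
  proof (rule integral_mono)
    show "2 * \<bar>G (?Z \<omega>)\<bar> powr q + q * c\<^sup>2 * A2 (?Z \<omega>) \<le> \<bar>chaos J r (\<lambda>S. a S + c * b S) (?Z \<omega>)\<bar> powr q
      + \<bar>chaos J r (\<lambda>S. a S + (- c) * b S) (?Z \<omega>)\<bar> powr q" for \<omega>
      using powr_two_point_lower[OF q, of "G (?Z \<omega>)" "c * H (?Z \<omega>)"]
      unfolding chaos_add_scaled G_def[symmetric] H_def[symmetric] A2_def
      by (simp add: power_mult_distrib mult_ac)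
  qed (use G A2 IH in auto)
  also have "\<dots> \<le> weight_sum s (q / 2) J (\<lambda>S. a S + c * b S) + weight_sum s (q / 2) J (\<lambda>S. a S + (- c) * b S)"
    by (subst Bochner_Integration.integral_add[OF IH(1) IH(1)]) (intro add_mono IH(2))
  also have "\<dots> \<le> 2 * (\<Sum>S\<in>Pow J. s ^ card S * (tail_weight J S a + tail_weight J S b) powr (q / 2))"
    using q by (intro weight_sum_two_point s c) auto
  finally have two: "expectation (\<lambda>\<omega>. \<bar>G (?Z \<omega>)\<bar> powr q) + q * c\<^sup>2 / 2 * expectation (\<lambda>\<omega>. A2 (?Z \<omega>))
      \<le> (\<Sum>S\<in>Pow J. s ^ card S * (tail_weight J S a + tail_weight J S b) powr (q / 2))"
    by simp
  have "q * c\<^sup>2 / 2 = 1 / (4 * q)" unfolding c using q by (simp add: field_simps power2_eq_square)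
  then have "q\<^sup>2 * r\<^sup>2 \<le> q * c\<^sup>2 / 2" using r(2) by simp
  then have e2: "q\<^sup>2 * r\<^sup>2 * expectation (\<lambda>\<omega>. A2 (?Z \<omega>)) \<le> q * c\<^sup>2 / 2 * expectation (\<lambda>\<omega>. A2 (?Z \<omega>))"
    by (rule mult_right_mono) (simp add: A2_def)
  \<comment> \<open>The remainder: its coefficient is at most 1, and the moment bound on Z_i adds
    the factor s, which gives the second summand of \<open>weight_sum_insert\<close>.\<close>
  have "((q + 1) * r) powr q \<le> 1" using r q by (intro powr_le1) auto
  moreover have "expectation (\<lambda>\<omega>. A3 (?Z \<omega>)) * expectation (\<lambda>\<omega>. \<bar>Z i \<omega>\<bar> powr q) \<le> weight_sum s (q / 2) J b * s"
    using IH(2)[of b] mom[OF J(2)] s by (intro mult_mono) (auto simp: A3_def H_def weight_sum_nonneg)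
  ultimately have e3: "((q + 1) * r) powr q * (expectation (\<lambda>\<omega>. A3 (?Z \<omega>)) * expectation (\<lambda>\<omega>. \<bar>Z i \<omega>\<bar> powr q))
      \<le> 1 * (weight_sum s (q / 2) J b * s)"
    by (rule mult_mono) (simp_all add: A3_def)
  have "expectation (\<lambda>\<omega>. \<bar>F \<omega>\<bar> powr q) \<le> expectation B"
    by (rule integral_mono[OF intF intB FB])
  \<comment> \<open>Mean 0 removes the linear term, and variance 1 leaves the quadratic one without
    a factor from Z_i.\<close>
  also have "\<dots> = expectation (\<lambda>\<omega>. \<bar>G (?Z \<omega>)\<bar> powr q) + q\<^sup>2 * r\<^sup>2 * expectation (\<lambda>\<omega>. A2 (?Z \<omega>))
      + ((q + 1) * r) powr q * (expectation (\<lambda>\<omega>. A3 (?Z \<omega>)) * expectation (\<lambda>\<omega>. \<bar>Z i \<omega>\<bar> powr q))"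
    unfolding B_def using G P1 P2 P3 mean[OF J(2)] var[OF J(2)] by simp
  also have "\<dots> \<le> weight_sum s (q / 2) (insert i J) a"
    using two e2 e3 unfolding weight_sum_insert[OF insert.hyps] b_def[symmetric] by (simp add: mult.commute)
  finally show ?case using intF unfolding F_def by simp
qed

end

section \<open>Translation to norms\<close>

theorem theorem7p1:
  fixes M :: "'w measure" and n :: nat and Z :: "nat \<Rightarrow> 'w \<Rightarrow> real"
    and a :: "nat set \<Rightarrow> real" and q \<sigma> \<rho> :: real
  assumes "prob_space M"
    and "q \<ge> 2" and "\<sigma> > 0"
    and "prob_space.indep_vars M (\<lambda>_. borel) Z {1..n}"
    and "\<And>i. i \<in> {1..n} \<Longrightarrow> integrable M (\<lambda>\<omega>. \<bar>Z i \<omega>\<bar> powr q)"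
    and "\<And>i. i \<in> {1..n} \<Longrightarrow> (\<integral>\<omega>. Z i \<omega> \<partial>M) = 0"
    and "\<And>i. i \<in> {1..n} \<Longrightarrow> (\<integral>\<omega>. (Z i \<omega>)\<^sup>2 \<partial>M) = 1"
    and "\<And>i. i \<in> {1..n} \<Longrightarrow> (\<integral>\<omega>. \<bar>Z i \<omega>\<bar> powr q \<partial>M) \<le> \<sigma> powr (2 - q)"
    and "0 < \<rho>" and "\<rho> < 1 / (2 * q powr 1.5)"
  shows "Lr_norm M q (noise_op n Z \<rho> a) powr q
       \<le> (\<Sum>S\<in>Pow {1..n}. \<sigma> powr ((2 - q) * real (card S)) * Lr_norm M 2 (deriv_op n Z S a) powr q)"
proof -
  interpret prob_space M by fact
  let ?Z = "\<lambda>\<omega> i. Z i \<omega>"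
  \<comment> \<open>Squaring the hypothesis on \<rho> gives \<rho>^2 \<le> 1/(4 q^3); since q^1.5
    \<ge> q it also gives \<rho> \<le> 1/(2 q), and (q + 1)/(2 q) \<le> 1.\<close>
  have \<rho>: "q\<^sup>2 * \<rho>\<^sup>2 \<le> 1 / (4 * q)" "(q + 1) * \<rho> \<le> 1"
  proof -
    have sq: "(q powr 1.5)\<^sup>2 = q ^ 3"
    proof -
      have three: "(1.5 :: real) + 1.5 = 3" by simp
      show ?thesis
        using assms(2) powr_realpow[of q 3]
        unfolding power2_eq_square powr_add[symmetric] three by simp
    qed
    have "\<rho>\<^sup>2 \<le> (1 / (2 * q powr 1.5))\<^sup>2" using assms(9,10) by (intro power_mono) auto
    also have "\<dots> = 1 / (4 * q ^ 3)" unfolding power_divide power_mult_distrib sq by simp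
    finally have "q\<^sup>2 * \<rho>\<^sup>2 \<le> q\<^sup>2 * (1 / (4 * q ^ 3))" by (rule mult_left_mono) simp
    also have "\<dots> = 1 / (4 * q)" using assms(2) by (simp add: power2_eq_square power3_eq_cube)
    finally show "q\<^sup>2 * \<rho>\<^sup>2 \<le> 1 / (4 * q)" .
    have "q powr 1 \<le> q powr 1.5" using assms(2) by (intro powr_mono) auto
    then have "1 / (2 * q powr 1.5) \<le> 1 / (2 * q)" using assms(2) by (intro divide_left_mono) auto
    then have "\<rho> \<le> 1 / (2 * q)" using assms(10) by linarith
    then have "(q + 1) * \<rho> \<le> (q + 1) * (1 / (2 * q))" using assms(2) by (intro mult_left_mono) auto
    also have "\<dots> \<le> 1" using assms(2) by (simp add: field_simps)
    finally show "(q + 1) * \<rho> \<le> 1" .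
  qed
  have rv: "random_variable borel (Z i)" if "i \<in> {1..n}" for i
    using assms(4) that by (simp add: indep_vars_def)
  have int1: "integrable M (Z i)" and int2: "integrable M (\<lambda>\<omega>. (Z i \<omega>)\<^sup>2)" if "i \<in> {1..n}" for i
    using integrable_powr_imp_integrable_power[OF rv[OF that] assms(5)[OF that], of 1]
      integrable_powr_imp_integrable_power[OF rv[OF that] assms(5)[OF that], of 2] assms(2) by auto
  have deriv: "Lr_norm M 2 (deriv_op n Z S a) powr q = tail_weight {1..n} S a powr (q / 2)"
    if S: "S \<subseteq> {1..n}" for S
  proof -
    \<comment> \<open>Supersets of S correspond to subsets T of the complement through S \<union> T,
      so D_S f is a polynomial in the variables outside S with coefficients a (S \<union>
      T).\<close>
    have bij: "bij_betw (\<lambda>T. S \<union> T) (Pow ({1..n} - S)) {T. S \<subseteq> T \<and> T \<subseteq> {1..n}}"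
      using S by (intro bij_betwI[where g = "\<lambda>T. T - S"]) auto
    have "deriv_op n Z S a \<omega> = chaos ({1..n} - S) 1 (\<lambda>T. a (S \<union> T)) (?Z \<omega>)" for \<omega>
      unfolding deriv_op_def chaos_def sum.reindex_bij_betw[OF bij, symmetric]
      by (intro sum.cong) (auto intro!: prod.cong)
    then have "(\<integral>\<omega>. \<bar>deriv_op n Z S a \<omega>\<bar> powr 2 \<partial>M)
        = (\<integral>\<omega>. (chaos ({1..n} - S) 1 (\<lambda>T. a (S \<union> T)) (?Z \<omega>))\<^sup>2 \<partial>M)"
      by simp
    also have "\<dots> = tail_weight {1..n} S a"
      unfolding tail_weight_def
      using chaos_second_moment[OF assms(4) int1 int2 assms(6,7), of "{1..n} - S"] by simp
    finally show ?thesis by (simp add: Lr_norm_def powr_powr)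
  qed
  have "Lr_norm M q (noise_op n Z \<rho> a) powr q = (\<integral>\<omega>. \<bar>chaos {1..n} \<rho> a (?Z \<omega>)\<bar> powr q \<partial>M)"
    using assms(2) by (simp add: Lr_norm_def powr_powr noise_op_def chaos_def)
  also have "\<dots> \<le> weight_sum (\<sigma> powr (2 - q)) (q / 2) {1..n} a"
    using chaos_moment_le_weight_sum[OF assms(4,2) _ assms(5-8) _ \<rho>, of "{1..n}" a] assms(9) by simp
  also have "\<dots> = (\<Sum>S\<in>Pow {1..n}. \<sigma> powr ((2 - q) * real (card S)) * Lr_norm M 2 (deriv_op n Z S a) powr q)"
    unfolding weight_sum_def using assms(3)
    by (intro sum.cong) (auto simp: deriv powr_powr simp flip: powr_realpow)
  finally show ?thesis .
qed

end
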